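(* Let $q$ be any prime power. There exists a set of $q^{12}+2q^8+2q^7+q^6+q^5+q^4+1$ planes of the projective space ${\rm PG}(8,q)$ such that any two distinct planes of the set intersect in at most one point.
   Context: ${\rm PG}(8,q)$ is the projective space of dimension $8$ over the finite field ${\rm GF}(q)$; a plane is a $2$-dimensional projective subspace (a $3$-dimensional vector subspace of ${\rm GF}(q)^9$). *)

theory Defs
  imports "HOL-Analysis.Analysis"
begin

text \<open>Vectors of GF(q)^9 are modelled as 'a ^ 9 for a finite field 'a
 (with q = CARD('a)); scalar multiplication is componentwise.\<close>

definition vsmul :: "'a::field \<Rightarrow> 'a ^ 'n \<Rightarrow> 'a ^ 'n" where
  "vsmul c v = (\<chi> i. c * v $ i)"

lemma vector_space_vsmul: "vector_space (vsmul :: 'a::field \<Rightarrow> 'a ^ 'n \<Rightarrow> 'a ^ 'n)"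
  by unfold_locales (auto simp: vsmul_def vec_eq_iff algebra_simps)

text \<open>A projective plane of PG(8,q): a 3-dimensional vector subspace of GF(q)^9.\<close>
definition is_plane :: "('a::field ^ 9) set \<Rightarrow> bool" where
  "is_plane S \<longleftrightarrow> module.subspace vsmul S \<and> vector_space.dim vsmul S = 3"

end

theory Submission
  imports Defs
begin

text \<open>
  Write GF(q)^9 as a sum of three copies of GF(q)^3 and let M be a linear rank-distance code of
  q^6 matrices of size 3 x 3 whose nonzero members have rank at least 2. If C is a set of planes
  of PG(5,q) pairwise meeting in at most a point, then the graphs over the members of C of the
  maps in M form q^6 |C| planes of PG(8,q) with the same property, all skew to the last copy V of
  GF(q)^3. The plane V itself can be added. So can, for each line l of PG(5,q) contained in no
  member of C, the q^3 planes projecting onto l that come from a maximal partial line spread in the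
  dual of the span of l and V, provided the lines l used are pairwise skew. We need |C| = q^6 + 2q^2 + 2q + 1
  and q^2 + q such lines.

  The code M consists of the maps sending x to Dx x k + b x x (cross products), where D is a
  companion matrix with no eigenvalue in GF(q). The associated quadratic forms k . (x x Dx) form
  the net of conics through three conjugate points, and no nonzero form of the net vanishes on a
  line. For C, take the graphs of the members of M, remove those with k = 0 (the q^3 generators of
  one family of the Klein quadric x . y = 0 skew to x = 0), put in the q^3 + q^2 + q generators of
  the opposite family other than x = 0, and add for each line of the plane x = 0 one plane through
  it that meets the quadric in no other point.
\<close>

section \<open>Cross and dot products on GF(q)^3\<close>

definition cross :: "'a::comm_ring ^ 3 \<Rightarrow> 'a ^ 3 \<Rightarrow> 'a ^ 3" (infixl \<open>\<times>\<^sub>3\<close> 70) where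
  "x \<times>\<^sub>3 y = vector [x$2 * y$3 - x$3 * y$2, x$3 * y$1 - x$1 * y$3, x$1 * y$2 - x$2 * y$1]"

definition dot :: "'a::comm_ring ^ 3 \<Rightarrow> 'a ^ 3 \<Rightarrow> 'a" (infixl \<open>\<bullet>\<^sub>3\<close> 70) where
  "x \<bullet>\<^sub>3 y = x$1 * y$1 + x$2 * y$2 + x$3 * y$3"

lemmas coords = cross_def dot_def vec_eq_iff forall_3

lemma dot_linear:
  fixes x y z :: "'a::comm_ring_1 ^ 3"
  shows "x \<bullet>\<^sub>3 (y + z) = x \<bullet>\<^sub>3 y + x \<bullet>\<^sub>3 z" "(y + z) \<bullet>\<^sub>3 x = y \<bullet>\<^sub>3 x + z \<bullet>\<^sub>3 x"
    "x \<bullet>\<^sub>3 (a *s y) = a * (x \<bullet>\<^sub>3 y)" "(a *s y) \<bullet>\<^sub>3 x = a * (y \<bullet>\<^sub>3 x)"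
    "(y - z) \<bullet>\<^sub>3 x = y \<bullet>\<^sub>3 x - z \<bullet>\<^sub>3 x" "x \<bullet>\<^sub>3 0 = 0" "0 \<bullet>\<^sub>3 x = 0"
  by (simp_all add: coords algebra_simps)

lemma cross_linear:
  fixes x y z :: "'a::comm_ring_1 ^ 3"
  shows "x \<times>\<^sub>3 (y + z) = x \<times>\<^sub>3 y + x \<times>\<^sub>3 z" "(y + z) \<times>\<^sub>3 x = y \<times>\<^sub>3 x + z \<times>\<^sub>3 x"
    "x \<times>\<^sub>3 (a *s y) = a *s (x \<times>\<^sub>3 y)" "(a *s y) \<times>\<^sub>3 x = a *s (y \<times>\<^sub>3 x)"
    "x \<times>\<^sub>3 (y - z) = x \<times>\<^sub>3 y - x \<times>\<^sub>3 z" "(y - z) \<times>\<^sub>3 x = y \<times>\<^sub>3 x - z \<times>\<^sub>3 x"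
    "x \<times>\<^sub>3 0 = 0" "0 \<times>\<^sub>3 x = 0"
  by (simp_all add: coords algebra_simps)

lemma cross_anticomm: "y \<times>\<^sub>3 x = - (x \<times>\<^sub>3 (y :: 'a::comm_ring_1 ^ 3))"
  by (simp add: coords)

lemma cross_self [simp]: "x \<times>\<^sub>3 x = (0 :: 'a::comm_ring_1 ^ 3)"
  by (simp add: coords)

lemma dot_commute: "x \<bullet>\<^sub>3 y = y \<bullet>\<^sub>3 (x :: 'a::comm_ring_1 ^ 3)"
  by (simp add: dot_def mult.commute)

lemma dot_cross_self:
  fixes x y :: "'a::comm_ring_1 ^ 3"
  shows "x \<bullet>\<^sub>3 (x \<times>\<^sub>3 y) = 0" "x \<bullet>\<^sub>3 (y \<times>\<^sub>3 x) = 0" "(x \<times>\<^sub>3 y) \<bullet>\<^sub>3 x = 0" "(y \<times>\<^sub>3 x) \<bullet>\<^sub>3 x = 0"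
  by (simp_all add: coords algebra_simps)

lemma cross_cross:
  "(x \<times>\<^sub>3 y) \<times>\<^sub>3 z = (x \<bullet>\<^sub>3 z) *s y - (y \<bullet>\<^sub>3 z) *s (x :: 'a::comm_ring_1 ^ 3)"
  by (simp add: coords algebra_simps)

lemma cross_eq_0_imp_scale:
  fixes u v :: "'a::field ^ 3"
  assumes "u \<times>\<^sub>3 v = 0" "u \<noteq> 0"
  obtains a where "v = a *s u"
proof -
  from assms(2) consider "u$1 \<noteq> 0" | "u$2 \<noteq> 0" | "u$3 \<noteq> 0" by (auto simp: vec_eq_iff forall_3)
  then have "\<exists>a. v = a *s u"
  proof cases
    case 1 with assms(1) show ?thesis
      by (intro exI[of _ "v$1 / u$1"]) (auto simp: coords field_simps)
  next
    case 2 with assms(1) show ?thesis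
      by (intro exI[of _ "v$2 / u$2"]) (auto simp: coords field_simps)
  next
    case 3 with assms(1) show ?thesis
      by (intro exI[of _ "v$3 / u$3"]) (auto simp: coords field_simps)
  qed
  with that show ?thesis by blast
qed

lemma cross_eq_0_imp_dep:
  fixes u v :: "'a::field ^ 3"
  assumes "u \<times>\<^sub>3 v = 0"
  obtains a b where "a \<noteq> 0 \<or> b \<noteq> 0" "a *s u + b *s v = 0"
proof (cases "u = 0")
  case True
  show ?thesis by (rule that[of 1 0]) (auto simp: True)
next
  case False
  with assms obtain a where "v = a *s u" using cross_eq_0_imp_scale by blast
  then show ?thesis by (intro that[of "- a" 1]) auto
qed

lemma dep_imp_cross_eq_0:
  fixes u v :: "'a::field ^ 3"
  assumes "a \<noteq> 0 \<or> b \<noteq> 0" "a *s u + b *s v = 0"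
  shows "u \<times>\<^sub>3 v = 0"
proof -
  have "a *s (u \<times>\<^sub>3 v) = (a *s u + b *s v) \<times>\<^sub>3 v" "b *s (u \<times>\<^sub>3 v) = u \<times>\<^sub>3 (a *s u + b *s v)"
    by (simp_all add: cross_linear)
  with assms show ?thesis by (auto simp: cross_linear)
qed

lemma cross_scales [simp]: "(a *s x) \<times>\<^sub>3 (b *s x) = (0 :: 'a::field ^ 3)"
  by (simp add: cross_linear)

lemma cross_12_zero:
  fixes u v :: "'a::comm_ring_1 ^ 3"
  assumes "u$1 = 0 \<and> u$2 = 0" "v$1 = 0 \<and> v$2 = 0"
  shows "u \<times>\<^sub>3 v = 0"
  using assms by (simp add: coords)

lemma parallel_trans:
  fixes e u v :: "'a::field ^ 3"
  assumes "e \<noteq> 0" "u \<times>\<^sub>3 e = 0" "v \<times>\<^sub>3 e = 0"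
  shows "u \<times>\<^sub>3 v = 0"
proof -
  have "e \<times>\<^sub>3 u = 0" "e \<times>\<^sub>3 v = 0" using assms cross_anticomm[of e] by auto
  then obtain a b where "u = a *s e" "v = b *s e" using cross_eq_0_imp_scale assms(1) by metis
  then show ?thesis by simp
qed

text \<open>Expanding the triple product shows that \<open>u\<close> and \<open>v\<close> are both
  parallel to the normal of the plane of \<open>e\<close> and \<open>f\<close>.\<close>

lemma common_perp_parallel:
  fixes e f u v :: "'a::field ^ 3"
  assumes "e \<times>\<^sub>3 f \<noteq> 0" "e \<bullet>\<^sub>3 u = 0" "f \<bullet>\<^sub>3 u = 0" "e \<bullet>\<^sub>3 v = 0" "f \<bullet>\<^sub>3 v = 0"
  shows "u \<times>\<^sub>3 v = 0"
proof -
  have "u \<times>\<^sub>3 (e \<times>\<^sub>3 f) = 0" and "v \<times>\<^sub>3 (e \<times>\<^sub>3 f) = 0"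
    by (simp_all add: cross_anticomm[of u] cross_anticomm[of v] cross_cross assms)
  with assms(1) parallel_trans show ?thesis by blast
qed

lemma ex_dual:
  fixes u :: "'a::field ^ 3"
  assumes "u \<noteq> 0"
  shows "\<exists>e. u \<bullet>\<^sub>3 e = 1"
proof -
  from assms consider "u$1 \<noteq> 0" | "u$2 \<noteq> 0" | "u$3 \<noteq> 0" by (auto simp: vec_eq_iff forall_3)
  then show ?thesis
  proof cases
    case 1 then show ?thesis by (intro exI[of _ "vector [1 / u$1, 0, 0]"]) (simp add: dot_def)
  next
    case 2 then show ?thesis by (intro exI[of _ "vector [0, 1 / u$2, 0]"]) (simp add: dot_def)
  next
    case 3 then show ?thesis by (intro exI[of _ "vector [0, 0, 1 / u$3]"]) (simp add: dot_def)
  qed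
qed

lemma perp_expansion:
  fixes x y v :: "'a::field ^ 3"
  assumes "x \<times>\<^sub>3 y \<noteq> 0" "(x \<times>\<^sub>3 y) \<bullet>\<^sub>3 v = 0"
  obtains a b where "v = a *s x + b *s y"
proof -
  let ?u = "x \<times>\<^sub>3 y"
  obtain e where e: "?u \<bullet>\<^sub>3 e = 1" using ex_dual[OF assms(1)] by blast
  \<comment> \<open>Cramer's rule for \<open>v\<close> in the basis \<open>x\<close>,
    \<open>y\<close>, \<open>e\<close>, whose determinant \<open>?u \<bullet>\<^sub>3 e\<close> is
    1.\<close>
  have "(?u \<bullet>\<^sub>3 e) *s v = ((v \<times>\<^sub>3 y) \<bullet>\<^sub>3 e) *s x + ((x \<times>\<^sub>3 v) \<bullet>\<^sub>3 e) *s y + (?u \<bullet>\<^sub>3 v) *s e"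
    by (simp add: coords algebra_simps)
  with e assms(2) show ?thesis by (intro that) simp
qed

section \<open>The companion matrix and its net of conics\<close>

text \<open>The characteristic polynomial is t^3 - t - c.\<close>

definition companion :: "'a::comm_ring_1 \<Rightarrow> 'a ^ 3 \<Rightarrow> 'a ^ 3" where
  "companion c x = vector [x$2, x$3, c * x$1 + x$2]"

definition companion_tr :: "'a::comm_ring_1 \<Rightarrow> 'a ^ 3 \<Rightarrow> 'a ^ 3" where
  "companion_tr c x = vector [c * x$3, x$1 + x$3, x$2]"

lemma companion_linear:
  "companion c (x + y) = companion c x + companion c y"
  "companion c (a *s x) = a *s companion c x"
  "companion_tr c (x + y) = companion_tr c x + companion_tr c y"
  "companion_tr c (x - y) = companion_tr c x - companion_tr c y"
  by (simp_all add: companion_def companion_tr_def coords algebra_simps)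

lemma companion_adjoint: "companion_tr c x \<bullet>\<^sub>3 y = x \<bullet>\<^sub>3 companion c y"
  by (simp add: companion_def companion_tr_def coords algebra_simps)

text \<open>A nonzero eigenvector is a multiple of (1, t, t^2), and its last coordinate makes t a
  root of the characteristic polynomial.\<close>

lemma companion_no_eigenvector:
  fixes c :: "'a::field"
  assumes c: "\<And>t. t ^ 3 - t \<noteq> c" and "x \<times>\<^sub>3 companion c x = 0"
  shows "x = 0"
proof (cases "x$1 = 0")
  case True
  then show ?thesis using assms(2) by (auto simp: companion_def coords)
next
  case False
  define t where "t = x$2 / x$1"
  have x2: "x$2 = t * x$1" using False by (simp add: t_def)
  have "x$1 * (x$3 - t * t * x$1) = 0" "x$3 * x$2 = x$1 * (c * x$1 + x$2)"
    using assms(2) x2 by (auto simp: companion_def coords algebra_simps)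
  then have x3: "x$3 = t * t * x$1" and "x$3 * x$2 = x$1 * (c * x$1 + x$2)"
    using False by auto
  then have "x$1 * x$1 * (t ^ 3 - t - c) = 0"
    unfolding x2 x3 by (simp add: algebra_simps power3_eq_cube)
  with False c[of t] show ?thesis by simp
qed

text \<open>Here an eigenvector would be a multiple of (t^2 - 1, t, 1).\<close>

lemma companion_tr_no_eigenvector:
  fixes c :: "'a::field"
  assumes c: "\<And>t. t ^ 3 - t \<noteq> c" and "x \<times>\<^sub>3 companion_tr c x = 0"
  shows "x = 0"
proof (cases "x$3 = 0")
  case True
  then show ?thesis using assms(2) by (auto simp: companion_tr_def coords)
next
  case False
  define t where "t = x$2 / x$3"
  have x2: "x$2 = t * x$3" using False by (simp add: t_def)
  have "x$3 * (x$1 - (t * t - 1) * x$3) = 0" "c * x$3 * x$3 = x$1 * x$2"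
    using assms(2) x2 by (auto simp: companion_tr_def coords algebra_simps)
  then have x1: "x$1 = (t * t - 1) * x$3" and "c * x$3 * x$3 = x$1 * x$2"
    using False by auto
  then have "x$3 * x$3 * (t ^ 3 - t - c) = 0"
    unfolding x2 x1 by (simp add: algebra_simps power3_eq_cube)
  with False c[of t] show ?thesis by simp
qed

text \<open>If v, Dv, DDv were dependent, the normal \<open>?e\<close> of the plane of v and Dv
  would be parallel to its image under the transpose, hence 0; then v would be an eigenvector of
  D.\<close>

lemma companion_cyclic:
  fixes c :: "'a::field"
  assumes c: "\<And>t. t ^ 3 - t \<noteq> c" and "v \<noteq> 0"
  shows "v \<bullet>\<^sub>3 (companion c v \<times>\<^sub>3 companion c (companion c v)) \<noteq> 0"
proof
  let ?w = "companion c v"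
  let ?e = "v \<times>\<^sub>3 ?w"
  assume *: "v \<bullet>\<^sub>3 (?w \<times>\<^sub>3 companion c ?w) = 0"
  have "?e \<bullet>\<^sub>3 companion c ?w = 0"
    using * by (simp add: coords algebra_simps)
  then have "companion_tr c ?e \<bullet>\<^sub>3 v = 0" "companion_tr c ?e \<bullet>\<^sub>3 ?w = 0"
    by (simp_all add: companion_adjoint dot_cross_self)
  then have "?e \<times>\<^sub>3 companion_tr c ?e = 0"
    by (simp add: cross_cross dot_commute)
  then have "?e = 0" using companion_tr_no_eigenvector[OF c] by blast
  then show False using companion_no_eigenvector[OF c] assms(2) by blast
qed

text \<open>
  In the plane U spanned by x and y there is a vector v with Dv in U. The form and its
  polarisation then make k orthogonal to v x Dv, Dv x DDv and v x DDv, while v, Dv, DDv is a basis.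
\<close>

lemma quadratic_form_anisotropic_on_lines:
  fixes c :: "'a::field"
  assumes c: "\<And>t. t ^ 3 - t \<noteq> c"
    and x: "k \<bullet>\<^sub>3 (x \<times>\<^sub>3 companion c x) = 0" and y: "k \<bullet>\<^sub>3 (y \<times>\<^sub>3 companion c y) = 0"
    and xy: "k \<bullet>\<^sub>3 (x \<times>\<^sub>3 companion c y + y \<times>\<^sub>3 companion c x) = 0"
    and indep: "x \<times>\<^sub>3 y \<noteq> 0"
  shows "k = 0"
proof -
  let ?u = "x \<times>\<^sub>3 y"
  \<comment> \<open>Being orthogonal to \<open>?u\<close> and to \<open>companion_tr c ?u\<close>
    means that v and Dv both lie in U.\<close>
  define v where "v = ?u \<times>\<^sub>3 companion_tr c ?u"
  define w where "w = companion c v"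
  have "v \<noteq> 0" using companion_tr_no_eigenvector[OF c, of ?u] indep unfolding v_def by blast
  have "?u \<bullet>\<^sub>3 v = 0" "?u \<bullet>\<^sub>3 w = 0"
    unfolding w_def companion_adjoint[symmetric] by (simp_all add: v_def dot_cross_self)
  then obtain a b a' b' where v: "v = a *s x + b *s y" and w: "w = a' *s x + b' *s y"
    using perp_expansion[OF indep] by metis
  have xy': "k \<bullet>\<^sub>3 (x \<times>\<^sub>3 companion c y) = - (k \<bullet>\<^sub>3 (y \<times>\<^sub>3 companion c x))"
    using xy by (simp add: dot_linear eq_neg_iff_add_eq_0)
  have "k \<bullet>\<^sub>3 (p \<times>\<^sub>3 companion c r + r \<times>\<^sub>3 companion c p) = 0"
    if "p = d *s x + e *s y" "r = d' *s x + e' *s y" for p r d e d' e'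
    using x y xy' unfolding that
    by (simp only: companion_linear cross_linear dot_linear) (simp add: algebra_simps)
  from this[OF v w] have 1: "k \<bullet>\<^sub>3 (v \<times>\<^sub>3 companion c w) = 0"
    by (simp add: w_def[symmetric])
  have "k \<bullet>\<^sub>3 (p \<times>\<^sub>3 companion c p) = 0" if "p = d *s x + e *s y" for p d e
    using x y xy' unfolding that
    by (simp only: companion_linear cross_linear dot_linear) (simp add: algebra_simps)
  from this[OF v] this[OF w] have 2: "k \<bullet>\<^sub>3 (v \<times>\<^sub>3 w) = 0" and 3: "k \<bullet>\<^sub>3 (w \<times>\<^sub>3 companion c w) = 0"
    by (simp_all add: w_def[symmetric])
  \<comment> \<open>Cramer's rule again, for \<open>k\<close> in the basis v, Dv, DDv.\<close>
  have "(v \<bullet>\<^sub>3 (w \<times>\<^sub>3 companion c w)) *s k = (k \<bullet>\<^sub>3 (w \<times>\<^sub>3 companion c w)) *s v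
      - (k \<bullet>\<^sub>3 (v \<times>\<^sub>3 companion c w)) *s w + (k \<bullet>\<^sub>3 (v \<times>\<^sub>3 w)) *s companion c w"
    by (simp add: coords algebra_simps)
  with 1 2 3 companion_cyclic[OF c \<open>v \<noteq> 0\<close>] show "k = 0" by (simp add: w_def)
qed

section \<open>Planes of PG(8,q) as ranges of linear embeddings\<close>

definition glue :: "'a ^ 3 \<Rightarrow> 'a ^ 3 \<Rightarrow> 'a ^ 3 \<Rightarrow> 'a ^ 9" where
  "glue x y z = (\<chi> i. if i = 1 then x$1 else if i = 2 then x$2 else if i = 3 then x$3
     else if i = 4 then y$1 else if i = 5 then y$2 else if i = 6 then y$3
     else if i = 7 then z$1 else if i = 8 then z$2 else z$3)"

lemma glue_add: "glue x y z + glue x' y' z' = glue (x + x') (y + y') (z + z')"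
  by (simp add: glue_def vec_eq_iff)

lemma glue_scale: "a *s glue x y z = glue (a *s x) (a *s y) (a *s z)"
  by (simp add: glue_def vec_eq_iff)

lemma glue_eq_iff: "glue x y z = glue x' y' z' \<longleftrightarrow> x = x' \<and> y = y' \<and> z = z'"
proof
  assume "glue x y z = glue x' y' z'"
  then have *: "glue x y z $ i = glue x' y' z' $ i" for i by simp
  show "x = x' \<and> y = y' \<and> z = z'"
    using *[of 1] *[of 2] *[of 3] *[of 4] *[of 5] *[of 6] *[of 7] *[of 8] *[of 9]
    by (simp add: glue_def vec_eq_iff forall_3)
qed auto

lemma vsmul_eq: "vsmul = (*s)"
  by (intro ext) (simp add: vsmul_def vec_eq_iff)

lemma dim_le_1:
  fixes S :: "('a::field ^ 'n) set"
  assumes "\<And>u v. u \<in> S \<Longrightarrow> v \<in> S \<Longrightarrow> \<exists>a b. (a \<noteq> 0 \<or> b \<noteq> 0) \<and> a *s u + b *s v = 0"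
  shows "vec.dim S \<le> 1"
proof (rule ccontr)
  assume dim: "\<not> vec.dim S \<le> 1"
  obtain B where B: "B \<subseteq> S" "vec.independent B" "card B = vec.dim S"
    by (rule vec.basis_exists[of S])
  have "\<not> card B \<le> Suc 0" using dim by (simp add: B(3))
  then have "\<not> (\<forall>u\<in>B. \<forall>v\<in>B. u = v)"
    using card_le_Suc0_iff_eq[OF vec.finiteI_independent[OF B(2)]] by simp
  then obtain u v where uv: "u \<in> B" "v \<in> B" "u \<noteq> v" by blast
  then have "u \<in> S" "v \<in> S" using B(1) by auto
  from assms[OF this] obtain a b where ab: "a \<noteq> 0 \<or> b \<noteq> 0" "a *s u + b *s v = 0" by blast
  have ind: "vec.independent {u, v}" using uv by (intro vec.independent_mono[OF B(2)]) auto
  have sum: "(\<Sum>w\<in>{u, v}. (if w = u then a else b) *s w) = 0" using uv(3) ab(2) by auto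
  have "(if w = u then a else b) = 0" if "w \<in> {u, v}" for w
    by (rule vec.independentD[OF ind _ _ sum that]) auto
  from this[of u] this[of v] ab(1) uv(3) show False by simp
qed

text \<open>Planes are handled through parametrisations by GF(q)^3, so that intersections become
  equations \<open>f z = g w\<close>.\<close>

definition embedding :: "('a::field ^ 3 \<Rightarrow> 'a ^ 9) \<Rightarrow> bool" where
  "embedding f \<longleftrightarrow> (\<forall>x y. f (x + y) = f x + f y) \<and> (\<forall>a x. f (a *s x) = a *s f x)
     \<and> (\<forall>x. f x = 0 \<longrightarrow> x = 0)"

lemma embeddingD:
  assumes "embedding f"
  shows "f (x + y) = f x + f y" "f (a *s x) = a *s f x" "f x = 0 \<Longrightarrow> x = 0" "f 0 = 0"
proof -
  show "f (a *s x) = a *s f x" for a x using assms by (simp add: embedding_def)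
  from this[of 0 0] show "f 0 = 0" by simp
qed (use assms in \<open>simp_all add: embedding_def\<close>)

lemma embedding_linear: "embedding f \<Longrightarrow> Vector_Spaces.linear (*s) (*s) f"
  by (simp add: embedding_def Vector_Spaces.linear_iff vec.vector_space_axioms)

lemma embedding_inj:
  assumes "embedding f"
  shows "inj f"
proof (rule injI)
  fix x y assume "f x = f y"
  moreover have "f (x - y) = f x - f y"
    using vec.linear_diff[OF embedding_linear[OF assms]] .
  ultimately have "f (x - y) = 0" by simp
  then have "x - y = 0" by (rule embeddingD(3)[OF assms])
  then show "x = y" by simp
qed

lemma embedding_range_is_plane:
  assumes "embedding f"
  shows "is_plane (range f)"
proof -
  note lin = embedding_linear[OF assms]
  have "vec.subspace (range f)"
    using vec.linear_subspace_image[OF lin] vec.subspace_UNIV by blast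
  moreover have "vec.dim (range f) = vec.dim (UNIV :: ('a ^ 3) set)"
    using embedding_inj[OF assms] by (intro vec.dim_image_eq[OF lin]) (auto intro: inj_on_subset)
  ultimately show ?thesis unfolding is_plane_def vsmul_eq vec_dim_card by simp
qed

text \<open>The vanishing cross product says that the common vectors of the two ranges are pairwise dependent.\<close>

definition meet_le_point :: "('a::field ^ 3 \<Rightarrow> 'a ^ 9) \<Rightarrow> ('a ^ 3 \<Rightarrow> 'a ^ 9) \<Rightarrow> bool" where
  "meet_le_point f g \<longleftrightarrow>
     (\<forall>z1 z2 w1 w2. f z1 = g w1 \<longrightarrow> f z2 = g w2 \<longrightarrow> z1 \<times>\<^sub>3 z2 = 0)"

lemma meet_le_point_dim:
  assumes f: "embedding f" and fg: "meet_le_point f g"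
  shows "vec.dim (range f \<inter> range g) \<le> 1"
proof (rule dim_le_1)
  fix u v assume "u \<in> range f \<inter> range g" "v \<in> range f \<inter> range g"
  then obtain z1 z2 w1 w2 where uv: "u = f z1" "v = f z2" and "f z1 = g w1" "f z2 = g w2"
    by auto
  with fg have "z1 \<times>\<^sub>3 z2 = 0" by (auto simp: meet_le_point_def)
  then obtain a b where ab: "a \<noteq> 0 \<or> b \<noteq> 0" "a *s z1 + b *s z2 = 0"
    by (rule cross_eq_0_imp_dep)
  have "a *s u + b *s v = f (a *s z1 + b *s z2)"
    by (simp add: uv embeddingD[OF f])
  then have "a *s u + b *s v = 0" by (simp add: ab(2) embeddingD(4)[OF f])
  with ab(1) show "\<exists>a b. (a \<noteq> 0 \<or> b \<noteq> 0) \<and> a *s u + b *s v = 0" by blast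
qed

text \<open>The condition concerns the parameters of the first map only. A dependence between
  parameters of \<open>f\<close> passes to the common vectors and, \<open>g\<close> being injective,
  to its parameters.\<close>

lemma meet_le_point_sym:
  assumes f: "embedding f" and g: "embedding g" and fg: "meet_le_point f g"
  shows "meet_le_point g f"
  unfolding meet_le_point_def
proof (intro allI impI)
  fix z1 z2 w1 w2 assume *: "g z1 = f w1" "g z2 = f w2"
  then have "w1 \<times>\<^sub>3 w2 = 0" using fg unfolding meet_le_point_def by (metis (no_types))
  then obtain a b where ab: "a \<noteq> 0 \<or> b \<noteq> 0" "a *s w1 + b *s w2 = 0"
    by (rule cross_eq_0_imp_dep)
  have "g (a *s z1 + b *s z2) = f (a *s w1 + b *s w2)"
    by (simp add: embeddingD[OF f] embeddingD[OF g] *)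
  then have "a *s z1 + b *s z2 = 0"
    by (intro embeddingD(3)[OF g]) (simp add: ab(2) embeddingD(4)[OF f])
  with ab(1) show "z1 \<times>\<^sub>3 z2 = 0" by (rule dep_imp_cross_eq_0)
qed

text \<open>Distinct indices give distinct planes, since equal ranges would meet in dimension
  3.\<close>

lemma planes_of_embeddings:
  assumes emb: "\<And>i. i \<in> I \<Longrightarrow> embedding (f i)"
    and meet: "\<And>i j. i \<in> I \<Longrightarrow> j \<in> I \<Longrightarrow> i \<noteq> j \<Longrightarrow> meet_le_point (f i) (f j)"
  defines "P \<equiv> (\<lambda>i. range (f i)) ` I"
  shows "card P = card I" "\<forall>S\<in>P. is_plane S"
    "\<forall>S\<in>P. \<forall>T\<in>P. S \<noteq> T \<longrightarrow> vector_space.dim vsmul (S \<inter> T) \<le> 1"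
proof -
  have le: "vec.dim (range (f i) \<inter> range (f j)) \<le> 1" if "i \<in> I" "j \<in> I" "i \<noteq> j" for i j
    using meet_le_point_dim[OF emb meet] that by blast
  have pl: "is_plane (range (f i))" if "i \<in> I" for i
    using embedding_range_is_plane[OF emb[OF that]] .
  have "inj_on (\<lambda>i. range (f i)) I"
  proof (rule inj_onI, rule ccontr)
    fix i j assume ij: "i \<in> I" "j \<in> I" "range (f i) = range (f j)" "i \<noteq> j"
    then have "vec.dim (range (f i)) \<le> 1" using le[of i j] by simp
    with pl[OF ij(1)] show False by (simp add: is_plane_def vsmul_eq)
  qed
  then show "card P = card I" unfolding P_def by (rule card_image)
  show "\<forall>S\<in>P. is_plane S" using pl by (auto simp: P_def)
  show "\<forall>S\<in>P. \<forall>T\<in>P. S \<noteq> T \<longrightarrow> vector_space.dim vsmul (S \<inter> T) \<le> 1"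
    unfolding vsmul_eq
  proof (intro ballI impI)
    fix S T assume "S \<in> P" "T \<in> P" "S \<noteq> T"
    then obtain i j where ij: "i \<in> I" "j \<in> I" "S = range (f i)" "T = range (f j)"
      by (auto simp: P_def)
    moreover from ij \<open>S \<noteq> T\<close> have "i \<noteq> j" by auto
    ultimately show "vec.dim (S \<inter> T) \<le> 1" using le by simp
  qed
qed

section \<open>The rank-distance code\<close>

definition mrd :: "'a::comm_ring_1 \<Rightarrow> 'a ^ 3 \<Rightarrow> 'a ^ 3 \<Rightarrow> 'a ^ 3 \<Rightarrow> 'a ^ 3" where
  "mrd c k b x = companion c x \<times>\<^sub>3 k + b \<times>\<^sub>3 x"

lemma mrd_linear:
  "mrd c k b (x + y) = mrd c k b x + mrd c k b y"
  "mrd c k b (a *s x) = a *s mrd c k b x"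
  "mrd c (k - k') (b - b') x = mrd c k b x - mrd c k' b' x"
  by (simp_all add: mrd_def companion_linear cross_linear algebra_simps)

text \<open>The product of x with b x x vanishes, which leaves the conic k . (x x Dx), and this
  contains no line.\<close>

lemma mrd_isotropic:
  fixes c :: "'a::field"
  assumes c: "\<And>t. t ^ 3 - t \<noteq> c" and "k \<noteq> 0"
    and "x \<bullet>\<^sub>3 mrd c k b x = 0" "y \<bullet>\<^sub>3 mrd c k b y = 0" "x \<bullet>\<^sub>3 mrd c k b y + y \<bullet>\<^sub>3 mrd c k b x = 0"
  shows "x \<times>\<^sub>3 y = 0"
proof (rule ccontr)
  assume "x \<times>\<^sub>3 y \<noteq> 0"
  moreover have "z \<bullet>\<^sub>3 mrd c k b z = k \<bullet>\<^sub>3 (z \<times>\<^sub>3 companion c z)" for z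
    by (simp add: mrd_def coords algebra_simps)
  moreover have "x \<bullet>\<^sub>3 mrd c k b y + y \<bullet>\<^sub>3 mrd c k b x
      = k \<bullet>\<^sub>3 (x \<times>\<^sub>3 companion c y + y \<times>\<^sub>3 companion c x)"
    by (simp add: mrd_def coords algebra_simps)
  ultimately show False
    using quadratic_form_anisotropic_on_lines[OF c, of k x y] assms by simp
qed

text \<open>This is rank at least 2. For \<open>k = 0\<close> the kernel is spanned by
  \<open>b\<close>; otherwise kernel vectors are isotropic.\<close>

lemma mrd_kernel:
  fixes c :: "'a::field"
  assumes c: "\<And>t. t ^ 3 - t \<noteq> c" and kb: "k \<noteq> 0 \<or> b \<noteq> 0"
    and xy: "mrd c k b x = 0" "mrd c k b y = 0"
  shows "x \<times>\<^sub>3 y = 0"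
proof (cases "k = 0")
  case True
  with kb xy have "b \<noteq> 0" "x \<times>\<^sub>3 b = 0" "y \<times>\<^sub>3 b = 0"
    by (simp_all add: mrd_def cross_linear cross_anticomm[of b])
  then show ?thesis by (rule parallel_trans)
next
  case False
  with mrd_isotropic[OF c False, of x b y] xy show ?thesis by (simp add: dot_linear)
qed

section \<open>The planes C of PG(5,q)\<close>

text \<open>Normalised representatives of all points of PG(2,q) except (0, 0, 1); these q^2 + q
  points will index the extra lines.\<close>

definition affine_points :: "('a::field ^ 3) set" where
  "affine_points = range (\<lambda>(y, z). vector [1, y, z]) \<union> range (\<lambda>z. vector [0, 1, z])"

definition points :: "('a::field ^ 3) set" where
  "points = insert (vector [0, 0, 1]) affine_points"

lemma points_indep: "a \<in> points \<Longrightarrow> b \<in> points \<Longrightarrow> a \<noteq> b \<Longrightarrow> a \<times>\<^sub>3 b \<noteq> 0"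
  by (auto simp: points_def affine_points_def coords)

lemma points_nonzero: "a \<in> points \<Longrightarrow> a \<noteq> 0"
  by (auto simp: points_def affine_points_def coords)

lemma card_affine_points:
  "card (affine_points :: ('a::{finite,field} ^ 3) set) = CARD('a) ^ 2 + CARD('a)"
proof -
  have "inj (\<lambda>(y, z). vector [1, y, z] :: 'a ^ 3)" "inj (\<lambda>z. vector [0, 1, z] :: 'a ^ 3)"
    by (auto simp: inj_on_def vec_eq_iff forall_3)
  moreover have "range (\<lambda>(y, z). vector [1, y, z] :: 'a ^ 3) \<inter> range (\<lambda>z. vector [0, 1, z]) = {}"
    by (auto simp: vec_eq_iff forall_3)
  ultimately show ?thesis
    unfolding affine_points_def
    by (simp add: card_Un_disjoint card_image power2_eq_square flip: UNIV_Times_UNIV)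
qed

lemma card_points:
  "card (points :: ('a::{finite,field} ^ 3) set) = CARD('a) ^ 2 + CARD('a) + 1"
proof -
  have "(vector [0, 0, 1] :: 'a ^ 3) \<notin> affine_points"
    by (auto simp: affine_points_def vec_eq_iff forall_3)
  then show ?thesis by (simp add: points_def card_affine_points)
qed

text \<open>
  The members of C: graphs of rank-distance code matrices with k nonzero, the generators of the
  Klein quadric of the second family skew to y = 0 (Skew) and meeting it in a line (Cone), and the
  planes through the lines a . y = 0 of x = 0 (Square).
\<close>

datatype 'a plane5 = is_Graph: Graph "'a ^ 3" "'a ^ 3" | is_Skew: Skew "'a ^ 3"
  | is_Cone: Cone "'a ^ 3" | is_Square: Square "'a ^ 3"

lemma finite_plane5: "finite (UNIV :: 'a::finite plane5 set)"
proof -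
  let ?R = "range (\<lambda>(k, b). Graph k b) \<union> range Skew \<union> range Cone \<union> range (Square :: 'a ^ 3 \<Rightarrow> _)"
  have "s \<in> ?R" for s by (cases s) auto
  then have "UNIV \<subseteq> ?R" by blast
  then show ?thesis by (rule finite_subset) simp
qed

definition dual :: "'a::field ^ 3 \<Rightarrow> 'a ^ 3" where
  "dual b = (SOME d. b \<bullet>\<^sub>3 d = 1)"

lemma dual: "b \<noteq> 0 \<Longrightarrow> b \<bullet>\<^sub>3 dual b = 1"
  unfolding dual_def using ex_dual by (rule someI_ex)

text \<open>The \<open>Cone\<close> plane consists of all (x, tb) with x orthogonal to b. On
  \<open>Skew\<close> and \<open>Cone\<close> planes x . y vanishes identically; on
  \<open>Square a\<close> it is the square of a . z, so only the line a . z = 0 lies on the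
  quadric.\<close>

primrec fst5 :: "'a::field plane5 \<Rightarrow> 'a ^ 3 \<Rightarrow> 'a ^ 3" where
  "fst5 (Graph k b) z = z"
| "fst5 (Skew b) z = z \<times>\<^sub>3 b"
| "fst5 (Cone b) z = z \<times>\<^sub>3 b"
| "fst5 (Square a) z = (a \<bullet>\<^sub>3 z) *s a"

primrec snd5 :: "'a::field \<Rightarrow> 'a plane5 \<Rightarrow> 'a ^ 3 \<Rightarrow> 'a ^ 3" where
  "snd5 c (Graph k b) z = mrd c k b z"
| "snd5 c (Skew b) z = z"
| "snd5 c (Cone b) z = (dual b \<bullet>\<^sub>3 z) *s b"
| "snd5 c (Square a) z = z"

text \<open>\<open>Skew 0\<close> would be the plane x = 0, which shares a line with every
  \<open>Square\<close> plane.\<close>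

definition code5 :: "'a::field plane5 set" where
  "code5 = (\<lambda>(k, b). Graph k b) ` ((- {0}) \<times> UNIV) \<union> Skew ` (- {0})
     \<union> Cone ` points \<union> Square ` points"

lemma card_code5:
  fixes q :: nat
  defines "q \<equiv> CARD('a::{finite,field})"
  shows "card (code5 :: 'a plane5 set) = q ^ 6 + 2 * q ^ 2 + 2 * q + 1"
proof -
  let ?G = "(\<lambda>(k, b). Graph k b) ` ((- {0 :: 'a ^ 3}) \<times> UNIV)"
  let ?S = "Skew ` (- {0 :: 'a ^ 3})"
  have q3: "card (- {0 :: 'a ^ 3}) = q ^ 3 - 1" by (simp add: Compl_eq_Diff_UNIV card_Diff_singleton q_def)
  have G: "card ?G = (q ^ 3 - 1) * q ^ 3"
    by (subst card_image) (auto simp: inj_on_def card_cartesian_product q3, simp add: q_def)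
  have S: "card ?S = q ^ 3 - 1" by (subst card_image) (auto simp: inj_on_def q3)
  have C: "card (Cone ` points :: 'a plane5 set) = q ^ 2 + q + 1"
    by (subst card_image) (auto simp: inj_on_def card_points q_def)
  have Q: "card (Square ` points :: 'a plane5 set) = q ^ 2 + q + 1"
    by (subst card_image) (auto simp: inj_on_def card_points q_def)
  have fin: "finite A" for A :: "'a plane5 set"
    using finite_plane5 subset_UNIV by (rule finite_subset[rotated])
  let ?C = "Cone ` points :: 'a plane5 set"
  let ?Q = "Square ` points :: 'a plane5 set"
  have "?G \<inter> ?S = {}" "(?G \<union> ?S) \<inter> ?C = {}" "(?G \<union> ?S \<union> ?C) \<inter> ?Q = {}" by auto
  then have "card (code5 :: 'a plane5 set) = card ?G + card ?S + card ?C + card ?Q"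
    unfolding code5_def by (simp only: card_Un_disjoint[OF fin fin])
  then have "card (code5 :: 'a plane5 set) = (q ^ 3 - 1) * q ^ 3 + (q ^ 3 - 1) + (q ^ 2 + q + 1) + (q ^ 2 + q + 1)"
    by (simp only: G S C Q)
  \<comment> \<open>Writing q^3 as a successor removes the truncated subtraction.\<close>
  moreover obtain m where m: "q ^ 3 = Suc m" using gr0_implies_Suc[of "q ^ 3"] by (auto simp: q_def)
  have "q ^ 6 = q ^ 3 * q ^ 3" by (simp flip: power_add)
  then have "(q ^ 3 - 1) * q ^ 3 + (q ^ 3 - 1) + 1 = q ^ 6" by (simp add: m)
  ultimately show ?thesis by simp
qed

lemma five_linear:
  "fst5 s (x + y) = fst5 s x + fst5 s y" "fst5 s (a *s x) = a *s fst5 s x"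
  "snd5 c s (x + y) = snd5 c s x + snd5 c s y" "snd5 c s (a *s x) = a *s snd5 c s x"
  by (cases s; simp add: cross_linear dot_linear mrd_linear vec.scale_left_distrib)+

lemma five_inj:
  assumes "s \<in> code5" "fst5 s z = 0" "snd5 c s z = 0"
  shows "z = 0"
proof (cases s)
  case (Cone b)
  then have b: "b \<noteq> 0" using assms(1) points_nonzero by (auto simp: code5_def)
  have "b \<times>\<^sub>3 z = 0" using assms(2) Cone by (simp add: cross_anticomm[of z])
  then obtain a where "z = a *s b" using b cross_eq_0_imp_scale by blast
  with assms(3) Cone dual[OF b] b show ?thesis
    by (auto simp: dot_linear dot_commute[of "dual b"])
qed (use assms in auto)

text \<open>As b lies outside the plane orthogonal to \<open>dual b\<close>, the map z to z x b is
  injective on that plane, so parallel images come from parallel vectors. This settles the line y =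
  0 of a \<open>Cone\<close> plane.\<close>

lemma cone_line:
  fixes b :: "'a::field ^ 3"
  assumes "b \<noteq> 0" "dual b \<bullet>\<^sub>3 z1 = 0" "dual b \<bullet>\<^sub>3 z2 = 0" "(z1 \<times>\<^sub>3 b) \<times>\<^sub>3 (z2 \<times>\<^sub>3 b) = 0"
  shows "z1 \<times>\<^sub>3 z2 = 0"
proof -
  have "((z1 \<times>\<^sub>3 z2) \<bullet>\<^sub>3 b) *s b = (z1 \<times>\<^sub>3 b) \<times>\<^sub>3 (z2 \<times>\<^sub>3 b)"
    by (simp add: coords algebra_simps)
  with assms have zb: "b \<bullet>\<^sub>3 (z1 \<times>\<^sub>3 z2) = 0" by (simp add: dot_commute)
  have "dual b \<times>\<^sub>3 (z1 \<times>\<^sub>3 z2) = 0"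
    using assms(2,3) by (simp add: cross_anticomm[of "dual b"] cross_cross dot_commute)
  moreover have "dual b \<noteq> 0" using dual[OF assms(1)] by (auto simp: dot_linear)
  ultimately obtain a where a: "z1 \<times>\<^sub>3 z2 = a *s dual b" using cross_eq_0_imp_scale by blast
  with zb dual[OF assms(1)] have "a = 0" by (simp add: dot_linear)
  with a show ?thesis by simp
qed

lemma indep_scale_eqD:
  fixes a b :: "'a::field ^ 3"
  assumes "a \<times>\<^sub>3 b \<noteq> 0" "x *s a = y *s b"
  shows "x = 0" "y = 0"
proof -
  have "x *s (a \<times>\<^sub>3 b) = (x *s a) \<times>\<^sub>3 b" by (simp add: cross_linear)
  also have "\<dots> = 0" unfolding assms(2) by (simp add: cross_linear)
  finally show "x = 0" using assms(1) by simp
  have "y *s (a \<times>\<^sub>3 b) = a \<times>\<^sub>3 (y *s b)" by (simp add: cross_linear)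
  also have "\<dots> = 0" unfolding assms(2)[symmetric] by (simp add: cross_linear)
  finally show "y = 0" using assms(1) by simp
qed

text \<open>The last assumption selects one order of each pair of types; the other follows by symmetry.\<close>

lemma code5_meet_aux:
  fixes c :: "'a::field"
  assumes c: "\<And>t. t ^ 3 - t \<noteq> c" and st: "s \<in> code5" "t \<in> code5" "s \<noteq> t"
    and z: "fst5 s z1 = fst5 t w1" "snd5 c s z1 = snd5 c t w1"
      "fst5 s z2 = fst5 t w2" "snd5 c s z2 = snd5 c t w2"
    and ord: "is_Graph s \<or> \<not> is_Graph t \<and> (is_Skew s \<or> \<not> is_Skew t \<and> (is_Square s \<or> is_Cone t))"
  shows "z1 \<times>\<^sub>3 z2 = 0"
proof (cases s)
  case s: (Graph k b)
  then have k: "k \<noteq> 0" using st by (auto simp: code5_def)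
  show ?thesis
  proof (cases t)
    case (Graph k' b')
    with s z have "mrd c (k - k') (b - b') z1 = 0" "mrd c (k - k') (b - b') z2 = 0"
      by (simp_all add: mrd_linear)
    moreover have "k - k' \<noteq> 0 \<or> b - b' \<noteq> 0" using Graph s st(3) by auto
    ultimately show ?thesis using mrd_kernel[OF c] by blast
  next
    case (Skew b')
    then have m: "mrd c k b z1 = w1" "mrd c k b z2 = w2" "z1 = w1 \<times>\<^sub>3 b'" "z2 = w2 \<times>\<^sub>3 b'"
      using s z by simp_all
    \<comment> \<open>A generator is totally singular for x . y, so the common vectors span a
      totally isotropic space for the form of the graph. The \<open>Cone\<close> case rests on the
      same idea.\<close>
    show ?thesis
      by (rule mrd_isotropic[OF c k, of _ b]; unfold m(1,2); unfold m(3,4))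
        (simp_all add: coords algebra_simps)
  next
    case (Cone b')
    then have "z1 = w1 \<times>\<^sub>3 b'" "z2 = w2 \<times>\<^sub>3 b'" using s z by simp_all
    then have "z1 \<bullet>\<^sub>3 b' = 0" "z2 \<bullet>\<^sub>3 b' = 0" by (simp_all add: dot_cross_self)
    then show ?thesis
      using s Cone z by (intro mrd_isotropic[OF c k, of _ b]) (simp_all add: dot_linear)
  next
    case (Square a)
    then show ?thesis using s z by simp
  qed
next
  case s: (Skew b)
  then have b: "b \<noteq> 0" using st by (auto simp: code5_def)
  show ?thesis
  proof (cases t)
    case (Graph k' b')
    then show ?thesis using ord s by simp
  next
    case (Skew b')
    with s z have "z1 \<times>\<^sub>3 (b - b') = 0" "z2 \<times>\<^sub>3 (b - b') = 0" by (auto simp: cross_linear)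
    moreover have "b - b' \<noteq> 0" using Skew s st(3) by auto
    ultimately show ?thesis using parallel_trans by blast
  next
    case (Cone b')
    then show ?thesis using s z by simp
  next
    case (Square a)
    \<comment> \<open>The form x . y vanishes on the \<open>Skew\<close> plane and is (a . z)^2 on
      the \<open>Square\<close> plane.\<close>
    have "z \<times>\<^sub>3 b = 0" if "z \<times>\<^sub>3 b = (a \<bullet>\<^sub>3 z) *s a" for z
    proof -
      have "z \<bullet>\<^sub>3 ((a \<bullet>\<^sub>3 z) *s a) = 0" unfolding that[symmetric] by (simp add: dot_cross_self)
      then have "a \<bullet>\<^sub>3 z = 0" by (simp add: dot_linear dot_commute[of z])
      with that show ?thesis by simp
    qed
    then show ?thesis using s Square z parallel_trans[OF b] by simp
  qed
next
  case s: (Cone b)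
  with ord obtain b' where t: "t = Cone b'" by (cases t) auto
  have b: "b \<noteq> 0" "b \<times>\<^sub>3 b' \<noteq> 0"
    using st s t points_nonzero points_indep by (auto simp: code5_def)
  \<comment> \<open>The second components are multiples of independent vectors, so common vectors
    have y = 0; their first components are orthogonal to both b and b'.\<close>
  have d: "dual b \<bullet>\<^sub>3 z1 = 0" "dual b \<bullet>\<^sub>3 z2 = 0"
    using indep_scale_eqD(1)[OF b(2)] z s t by auto
  have "b \<bullet>\<^sub>3 (z \<times>\<^sub>3 b) = 0 \<and> b' \<bullet>\<^sub>3 (z \<times>\<^sub>3 b) = 0" if "z \<times>\<^sub>3 b = w \<times>\<^sub>3 b'" for z w
  proof
    show "b' \<bullet>\<^sub>3 (z \<times>\<^sub>3 b) = 0" unfolding that by (rule dot_cross_self)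
  qed (rule dot_cross_self)
  moreover have "z1 \<times>\<^sub>3 b = w1 \<times>\<^sub>3 b'" "z2 \<times>\<^sub>3 b = w2 \<times>\<^sub>3 b'"
    using z s t by simp_all
  ultimately have "(z1 \<times>\<^sub>3 b) \<times>\<^sub>3 (z2 \<times>\<^sub>3 b) = 0"
    by (metis common_perp_parallel[OF b(2)])
  then show ?thesis using cone_line[OF b(1) d] by blast
next
  case s: (Square a)
  show ?thesis
  proof (cases t)
    case (Square a')
    then have a: "a \<times>\<^sub>3 a' \<noteq> 0" using st s points_indep by (auto simp: code5_def)
    show ?thesis
      using indep_scale_eqD[OF a] z s Square by (intro common_perp_parallel[OF a]) auto
  qed (use s z ord in auto)
qed

text \<open>PG(5,q) inside PG(8,q), so that \<open>embedding\<close> and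
  \<open>meet_le_point\<close> apply to C too.\<close>

definition fill :: "'a::field \<Rightarrow> 'a plane5 \<Rightarrow> 'a ^ 3 \<Rightarrow> 'a ^ 9" where
  "fill c s z = glue (fst5 s z) (snd5 c s z) 0"

lemma glue_eq_0_iff: "glue x y z = 0 \<longleftrightarrow> x = 0 \<and> y = 0 \<and> z = 0"
proof -
  have "glue 0 0 0 = 0" by (simp add: glue_def vec_eq_iff)
  then show ?thesis using glue_eq_iff[of x y z 0 0 0] by metis
qed

lemma embedding_fill: "s \<in> code5 \<Longrightarrow> embedding (fill c s)"
  unfolding embedding_def fill_def
  by (auto simp: glue_add glue_scale glue_eq_iff glue_eq_0_iff five_linear dest: five_inj)

lemma code5_meet:
  fixes c :: "'a::field"
  assumes c: "\<And>t. t ^ 3 - t \<noteq> c" and st: "s \<in> code5" "t \<in> code5" "s \<noteq> t"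
  shows "meet_le_point (fill c s) (fill c t)"
proof -
  let ?ord = "\<lambda>s t. is_Graph s \<or> \<not> is_Graph t \<and> (is_Skew s \<or> \<not> is_Skew t \<and> (is_Square s \<or> is_Cone t))"
  have *: "meet_le_point (fill c s) (fill c t)"
    if "s \<in> code5" "t \<in> code5" "s \<noteq> t" "?ord s t" for s t
    using code5_meet_aux[OF c] that unfolding meet_le_point_def fill_def glue_eq_iff by metis
  have "?ord s t \<or> ?ord t s" by (cases s; cases t) auto
  then show ?thesis using * st meet_le_point_sym embedding_fill by metis
qed

section \<open>Lines missed by C, and the planes of PG(8,q)\<close>

text \<open>
  The pairwise skew lines of PG(5,q) missed by C are spanned by (transversal g p, 0) and (0, p).
  The choice of g makes the quadratic form g z^2 - z + 1 of the second case anisotropic.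
\<close>

definition transversal :: "'a::field \<Rightarrow> 'a ^ 3 \<Rightarrow> 'a ^ 3" where
  "transversal g p = (if p$1 = 1 then vector [1, p$3, - p$2] else vector [0, 1 - p$3, g * p$3])"

text \<open>The first fact keeps the line out of \<open>Cone p\<close>, the second serves skewness.
  For p = (1, y, z) the product is 1; for p = (0, 1, z) a zero would give w - w^2 = g with w = 1/z.
  Two points of the latter kind have determinant g times the difference of their last
  coordinates.\<close>

lemma transversal_props:
  fixes g :: "'a::field"
  assumes g: "\<And>w. w - w ^ 2 \<noteq> g" and p: "p \<in> affine_points"
  shows "transversal g p \<bullet>\<^sub>3 p \<noteq> 0"
    and "q \<in> affine_points \<Longrightarrow> p \<noteq> q \<Longrightarrow> transversal g p \<times>\<^sub>3 transversal g q \<noteq> 0"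
proof -
  have g0: "g \<noteq> 0" using g[of 0] by auto
  have "1 - z + g * z * z \<noteq> 0" for z
  proof
    assume *: "1 - z + g * z * z = 0"
    then have "z \<noteq> 0" by auto
    with * have "1 / z - (1 / z) ^ 2 = g" by (simp add: field_simps power2_eq_square)
    with g show False by blast
  qed
  then show "transversal g p \<bullet>\<^sub>3 p \<noteq> 0"
    using p by (auto simp: affine_points_def transversal_def dot_def)
  show "transversal g p \<times>\<^sub>3 transversal g q \<noteq> 0" if q: "q \<in> affine_points" "p \<noteq> q"
    using p q g0 by (auto simp: affine_points_def transversal_def coords algebra_simps)
qed

text \<open>For all types but \<open>Cone\<close> one component is z itself or fixes z up to a
  scalar. For \<open>Cone b\<close> the argument depends on whether p is b.\<close>

lemma code5_meets_transversal:
  fixes c g :: "'a::field"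
  assumes c: "\<And>t. t ^ 3 - t \<noteq> c" and g: "\<And>w. w - w ^ 2 \<noteq> g"
    and s: "s \<in> code5" and p: "p \<in> affine_points"
    and z: "fst5 s z1 = a1 *s transversal g p" "snd5 c s z1 = b1 *s p"
      "fst5 s z2 = a2 *s transversal g p" "snd5 c s z2 = b2 *s p"
  shows "z1 \<times>\<^sub>3 z2 = 0"
proof (cases s)
  case (Cone b)
  then have b: "b \<in> points" "b \<noteq> 0" using s points_nonzero by (auto simp: code5_def)
  show ?thesis
  proof (cases "p = b")
    case True
    have "z \<times>\<^sub>3 b = 0" if "z \<times>\<^sub>3 b = a *s transversal g p" for z a
    proof -
      have "(a *s transversal g p) \<bullet>\<^sub>3 p = 0"
        unfolding that[symmetric] by (simp add: True dot_cross_self)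
      then have "a = 0" using transversal_props(1)[OF g p] by (simp add: dot_linear)
      with that show ?thesis by simp
    qed
    then show ?thesis using z Cone parallel_trans[OF b(2)] by simp
  next
    case False
    then have "b \<times>\<^sub>3 p \<noteq> 0" using b p points_indep by (auto simp: points_def)
    then have "dual b \<bullet>\<^sub>3 z1 = 0" "dual b \<bullet>\<^sub>3 z2 = 0"
      using indep_scale_eqD(1) z Cone by auto
    then show ?thesis using z Cone cone_line[OF b(2)] by simp
  qed
qed (use z in auto)

datatype 'a plane8 = Lift "'a plane5" "'a ^ 3" "'a ^ 3" | Tangent "'a ^ 3" "'a ^ 3" | Vertex

text \<open>\<open>Lift\<close> applies the code map to the parameter z. A \<open>Tangent\<close>
  plane is cut out of the span of its line and V by two linear equations, that is, by a line of the
  dual PG(4,q).\<close>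

primrec param :: "'a::field \<Rightarrow> 'a \<Rightarrow> 'a plane8 \<Rightarrow> 'a ^ 3 \<Rightarrow> 'a ^ 9" where
  "param c g (Lift s k b) z = glue (fst5 s z) (snd5 c s z) (mrd c k b z)"
| "param c g (Tangent p k) z = glue (z$1 *s transversal g p) (z$2 *s p)
     (vector [k \<bullet>\<^sub>3 z, companion_tr c k \<bullet>\<^sub>3 z, z$3])"
| "param c g Vertex z = glue 0 0 z"

definition code8 :: "'a::field plane8 set" where
  "code8 = insert Vertex ((\<lambda>(s, k, b). Lift s k b) ` (code5 \<times> UNIV \<times> UNIV)
     \<union> (\<lambda>(p, k). Tangent p k) ` (affine_points \<times> UNIV))"

lemma card_code8:
  fixes q :: nat
  defines "q \<equiv> CARD('a::{finite,field})"
  shows "card (code8 :: 'a plane8 set) = q^12 + 2*q^8 + 2*q^7 + q^6 + q^5 + q^4 + 1"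
proof -
  let ?L = "(\<lambda>(s, k, b). Lift s k b) ` ((code5 :: 'a plane5 set) \<times> UNIV \<times> UNIV)"
  let ?T = "(\<lambda>(p, k). Tangent p k) ` ((affine_points :: ('a ^ 3) set) \<times> UNIV)"
  have fin: "finite (code5 :: 'a plane5 set)" using finite_plane5 subset_UNIV by (rule finite_subset[rotated])
  have L: "card ?L = (q ^ 6 + 2 * q ^ 2 + 2 * q + 1) * (q ^ 3 * q ^ 3)"
    by (subst card_image)
      (auto simp: inj_on_def card_cartesian_product card_code5 simp flip: q_def)
  have T: "card ?T = (q ^ 2 + q) * q ^ 3"
    by (subst card_image)
      (auto simp: inj_on_def card_cartesian_product card_affine_points simp flip: q_def)
  have "finite ?L" "finite ?T" "?L \<inter> ?T = {}" "Vertex \<notin> ?L \<union> ?T" using fin by auto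
  then have "card (code8 :: 'a plane8 set) = card ?L + card ?T + 1"
    unfolding code8_def by (simp add: card_Un_disjoint)
  also have "\<dots> = q^12 + 2*q^8 + 2*q^7 + q^6 + q^5 + q^4 + 1"
    unfolding L T by (simp add: algebra_simps flip: power_add power_Suc)
  finally show ?thesis .
qed

lemma embedding_param:
  fixes c g :: "'a::field"
  assumes g: "\<And>w. w - w ^ 2 \<noteq> g" and i: "i \<in> code8"
  shows "embedding (param c g i)"
proof (cases i)
  case (Lift s k b)
  then have "s \<in> code5" using i by (auto simp: code8_def)
  then show ?thesis
    unfolding embedding_def Lift
    by (auto simp: glue_add glue_scale glue_eq_iff glue_eq_0_iff five_linear mrd_linear dest: five_inj)
next
  case (Tangent p k)
  then have p: "p \<in> affine_points" using i by (auto simp: code8_def)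
  then have "p \<noteq> 0" "transversal g p \<noteq> 0"
    using transversal_props(1)[OF g p] by (auto simp: dot_linear)
  moreover have "k \<bullet>\<^sub>3 (a *s x) = a * (k \<bullet>\<^sub>3 x)" for k a and x :: "'a ^ 3" by (rule dot_linear)
  ultimately show ?thesis
    unfolding embedding_def Tangent
    by (auto simp: glue_add glue_scale glue_eq_iff glue_eq_0_iff dot_linear
        vec.scale_left_distrib vec_eq_iff[where 'b = 3] forall_3)
next
  case Vertex
  then show ?thesis by (auto simp: embedding_def glue_add glue_scale glue_eq_0_iff)
qed

text \<open>Over the same s the parameters agree and lie in the kernel of a nonzero code map; over
  different s the projections to PG(5,q) already meet in at most a point.\<close>

lemma Lift_meet:
  fixes c g :: "'a::field"
  assumes c: "\<And>t. t ^ 3 - t \<noteq> c" and s: "s \<in> code5" "t \<in> code5"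
    and ne: "Lift s k b \<noteq> Lift t k' b'"
  shows "meet_le_point (param c g (Lift s k b)) (param c g (Lift t k' b'))"
proof (cases "s = t")
  case True
  have inj: "z = w" if "fst5 s z = fst5 s w" "snd5 c s z = snd5 c s w" for z w
  proof (rule injD[OF embedding_inj[OF embedding_fill[OF s(1), of c]]])
    show "fill c s z = fill c s w" using that by (simp add: fill_def)
  qed
  have "k - k' \<noteq> 0 \<or> b - b' \<noteq> 0" using ne True by auto
  then have ker: "z1 \<times>\<^sub>3 z2 = 0" if "mrd c k b z1 = mrd c k' b' z1" "mrd c k b z2 = mrd c k' b' z2" for z1 z2
    using mrd_kernel[OF c, of "k - k'" "b - b'" z1 z2] that by (simp add: mrd_linear)
  show ?thesis
    unfolding meet_le_point_def param.simps glue_eq_iff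
  proof (intro allI impI, elim conjE)
    fix z1 z2 w1 w2
    assume *: "fst5 s z1 = fst5 t w1" "snd5 c s z1 = snd5 c t w1" "mrd c k b z1 = mrd c k' b' w1"
      "fst5 s z2 = fst5 t w2" "snd5 c s z2 = snd5 c t w2" "mrd c k b z2 = mrd c k' b' w2"
    then have "z1 = w1" "z2 = w2" using inj[of z1 w1] inj[of z2 w2] True by simp_all
    then show "z1 \<times>\<^sub>3 z2 = 0" using ker[of z1 z2] * by simp
  qed
next
  case False
  then have "meet_le_point (fill c s) (fill c t)" using code5_meet[OF c] s by blast
  then show ?thesis unfolding meet_le_point_def fill_def param.simps glue_eq_iff by blast
qed

text \<open>For equal p, common parameters are orthogonal to e = k - k' and to its image under the
  transpose, which are independent for lack of eigenvectors. For different p the lines are skew, so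
  only the third parameter survives.\<close>

lemma Tangent_meet:
  fixes c g :: "'a::field"
  assumes c: "\<And>t. t ^ 3 - t \<noteq> c" and g: "\<And>w. w - w ^ 2 \<noteq> g"
    and p: "p \<in> affine_points" "p' \<in> affine_points"
    and ne: "Tangent p k \<noteq> Tangent p' k'"
  shows "meet_le_point (param c g (Tangent p k)) (param c g (Tangent p' k'))"
proof -
  have p0: "p \<noteq> 0" "transversal g p \<noteq> 0" "p' \<noteq> 0"
    using transversal_props(1)[OF g p(1)] transversal_props(1)[OF g p(2)] by (auto simp: dot_linear)
  show ?thesis
  proof (cases "p = p'")
    case True
    define e where "e = k - k'"
    have e: "e \<times>\<^sub>3 companion_tr c e \<noteq> 0"
      using companion_tr_no_eigenvector[OF c, of e] ne True unfolding e_def by auto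
    have "e \<bullet>\<^sub>3 z = 0 \<and> companion_tr c e \<bullet>\<^sub>3 z = 0"
      if "param c g (Tangent p k) z = param c g (Tangent p' k') w" for z w
    proof -
      have 1: "z$1 *s transversal g p = w$1 *s transversal g p" "z$2 *s p = w$2 *s p"
        and 2: "(vector [k \<bullet>\<^sub>3 z, companion_tr c k \<bullet>\<^sub>3 z, z$3] :: 'a ^ 3)
          = vector [k' \<bullet>\<^sub>3 w, companion_tr c k' \<bullet>\<^sub>3 w, w$3]"
        using that True by (simp_all add: glue_eq_iff)
      have 3: "k \<bullet>\<^sub>3 z = k' \<bullet>\<^sub>3 w" "companion_tr c k \<bullet>\<^sub>3 z = companion_tr c k' \<bullet>\<^sub>3 w" "z$3 = w$3"
        using 2 unfolding vec_eq_iff forall_3 vector_3 by blast+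
      have "z = w" using 1 3(3) p0 unfolding vec_eq_iff[of z] forall_3 by simp
      with 3 show ?thesis by (simp add: e_def companion_linear dot_linear)
    qed
    then show ?thesis unfolding meet_le_point_def using common_perp_parallel[OF e] by blast
  next
    case False
    then have ind: "transversal g p \<times>\<^sub>3 transversal g p' \<noteq> 0"
      using transversal_props(2)[OF g p(1)] p(2) by blast
    have ind': "p \<times>\<^sub>3 p' \<noteq> 0" using False p points_indep by (auto simp: points_def)
    have "z$1 = 0 \<and> z$2 = 0"
      if "param c g (Tangent p k) z = param c g (Tangent p' k') w" for z w
      using that indep_scale_eqD(1)[OF ind, of "z$1" "w$1"] indep_scale_eqD(1)[OF ind', of "z$2" "w$2"]
      unfolding param.simps glue_eq_iff by blast
    then show ?thesis unfolding meet_le_point_def by (intro allI impI cross_12_zero)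
  qed
qed

lemma param_meet:
  fixes c g :: "'a::field"
  assumes c: "\<And>t. t ^ 3 - t \<noteq> c" and g: "\<And>w. w - w ^ 2 \<noteq> g"
    and ij: "i \<in> code8" "j \<in> code8" "i \<noteq> j"
  shows "meet_le_point (param c g i) (param c g j)"
proof -
  \<comment> \<open>Forgetting the third component reduces this case to PG(5,q).\<close>
  have LT: "meet_le_point (param c g (Lift s k b)) (param c g (Tangent p k'))"
    if "s \<in> code5" "p \<in> affine_points" for s k b p k'
    using code5_meets_transversal[OF c g that]
    unfolding meet_le_point_def param.simps glue_eq_iff by blast
  have LV: "meet_le_point (param c g (Lift s k b)) (param c g Vertex)" if "s \<in> code5" for s k b
    unfolding meet_le_point_def param.simps glue_eq_iff
  proof (intro allI impI, elim conjE)
    fix z1 z2 assume "fst5 s z1 = 0" "snd5 c s z1 = 0"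
    then have "z1 = 0" by (rule five_inj[OF that])
    then show "z1 \<times>\<^sub>3 z2 = 0" by (simp add: cross_linear)
  qed
  have TV: "meet_le_point (param c g (Tangent p k)) (param c g Vertex)" if "p \<in> affine_points" for p k
  proof -
    have "p \<noteq> 0" "transversal g p \<noteq> 0"
      using transversal_props(1)[OF g that] by (auto simp: dot_linear)
    then show ?thesis by (auto simp: meet_le_point_def glue_eq_iff intro: cross_12_zero)
  qed
  note emb = embedding_param[OF g, of _ c]
  note sym = meet_le_point_sym[OF emb emb]
  note ij8 = ij(1,2)
  show ?thesis
  proof (cases i)
    case i: (Lift s k b)
    then have s: "s \<in> code5" using ij by (auto simp: code8_def)
    show ?thesis
      using ij i LV[OF s] LT[OF s] Lift_meet[OF c s] by (cases j) (auto simp: code8_def)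
  next
    case i: (Tangent p k)
    then have p: "p \<in> affine_points" using ij by (auto simp: code8_def)
    show ?thesis
    proof (cases j)
      case j: (Lift s k' b)
      then have "s \<in> code5" using ij by (auto simp: code8_def)
      from sym[OF _ _ LT[OF this p]] show ?thesis using ij8 i j by simp
    next
      case j: (Tangent p' k')
      then have "p' \<in> affine_points" using ij by (auto simp: code8_def)
      then show ?thesis using Tangent_meet[OF c g p] i j ij(3) by blast
    next
      case Vertex
      then show ?thesis using TV[OF p] i by simp
    qed
  next
    case i: Vertex
    show ?thesis
    proof (cases j)
      case j: (Lift s k' b)
      then have "s \<in> code5" using ij by (auto simp: code8_def)
      from sym[OF _ _ LV[OF this]] show ?thesis using ij8 i j by simp
    next
      case j: (Tangent p' k')
      then have "p' \<in> affine_points" using ij by (auto simp: code8_def)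
      from sym[OF _ _ TV[OF this]] show ?thesis using ij8 i j by simp
    next
      case Vertex
      then show ?thesis using ij(3) i by simp
    qed
  qed
qed

section \<open>Choice of the constants and conclusion\<close>

text \<open>A self-map of a finite set that repeats a value misses one. Both t^3 - t and w - w^2
  vanish at 0 and 1, so c and g exist over every finite field.\<close>

lemma ex_notin_range:
  fixes f :: "'a::{finite,zero_neq_one} \<Rightarrow> 'a"
  assumes "f 0 = f 1"
  shows "\<exists>c. \<forall>t. f t \<noteq> c"
proof (rule ccontr)
  assume "\<not> ?thesis"
  then have "surj f" by (metis surj_def)
  then have "inj f" by (simp add: finite_UNIV_surj_inj)
  with assms show False using injD zero_neq_one by metis
qed

theorem theorem3p13:
  fixes q :: nat
  assumes "q = CARD('a::{finite,field})"
  shows "\<exists>P :: ('a ^ 9) set set.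
           card P = q^12 + 2*q^8 + 2*q^7 + q^6 + q^5 + q^4 + 1 \<and>
           (\<forall>S\<in>P. is_plane S) \<and>
           (\<forall>S\<in>P. \<forall>T\<in>P. S \<noteq> T \<longrightarrow> vector_space.dim vsmul (S \<inter> T) \<le> 1)"
proof -
  obtain c :: 'a where c: "\<And>t. t ^ 3 - t \<noteq> c"
    using ex_notin_range[of "\<lambda>t :: 'a. t ^ 3 - t"] by auto
  obtain g :: 'a where g: "\<And>w. w - w ^ 2 \<noteq> g"
    using ex_notin_range[of "\<lambda>w :: 'a. w - w ^ 2"] by auto
  show ?thesis
    using planes_of_embeddings[of code8 "param c g", OF embedding_param[OF g] param_meet[OF c g]]
    unfolding card_code8 assms by blast
qed

end
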